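(* Let $k\ge 2$ be an integer and $\varepsilon>0$. There exist constants $c=c(k,\varepsilon)>0$ and $n_0=n_0(k,\varepsilon)$ such that every graph $G$ on $n\ge n_0$ vertices with \[ q(G)\ge \left(1-\frac{1}{k}+\varepsilon\right)2n \] contains a copy of $K_{k+1}[t]$ for some $t\ge c\log n$.
   Context: All graphs are finite and simple. For a graph $G$, $q(G)$ denotes the largest eigenvalue of the signless Laplacian $Q(G)=D(G)+A(G)$, where $D(G)$ is the diagonal degree matrix and $A(G)$ the adjacency matrix. For a graph $F$ and integer $t\ge1$, the $t$-blowup $F[t]$ is obtained by replacing every vertex of $F$ by an independent set of size $t$ and every edge of $F$ by a complete bipartite graph $K_{t,t}$ between the corresponding sets. Thus $K_{k+1}[t]$ is the complete $(k+1)$-partite graph with all parts of size $t$. *)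

theory Defs
  imports "Jordan_Normal_Form.Char_Poly" Complex_Main
begin

definition simple_graph :: "nat \<Rightarrow> (nat \<Rightarrow> nat \<Rightarrow> bool) \<Rightarrow> bool" where
  "simple_graph n E \<longleftrightarrow> (\<forall>i<n. \<forall>j<n. E i j \<longleftrightarrow> E j i) \<and> (\<forall>i<n. \<not> E i i)"

definition degree :: "nat \<Rightarrow> (nat \<Rightarrow> nat \<Rightarrow> bool) \<Rightarrow> nat \<Rightarrow> nat" where
  "degree n E i = card {j. j < n \<and> E i j}"

definition signless_laplacian :: "nat \<Rightarrow> (nat \<Rightarrow> nat \<Rightarrow> bool) \<Rightarrow> real mat" where
  "signless_laplacian n E = mat n n (\<lambda>(i, j).
     (if i = j then real (degree n E i) else 0) + (if E i j then 1 else 0))"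

definition q_index :: "nat \<Rightarrow> (nat \<Rightarrow> nat \<Rightarrow> bool) \<Rightarrow> real" where
  "q_index n E = Max {x. eigenvalue (signless_laplacian n E) x}"

text \<open>G contains a copy (subgraph, not necessarily induced) of the blowup K_{r}[t]:
  r pairwise disjoint vertex classes of size t with all edges between distinct classes.\<close>
definition contains_complete_multipartite ::
  "nat \<Rightarrow> (nat \<Rightarrow> nat \<Rightarrow> bool) \<Rightarrow> nat \<Rightarrow> nat \<Rightarrow> bool" where
  "contains_complete_multipartite n E r t \<longleftrightarrow>
     (\<exists>V :: nat \<Rightarrow> nat set.
        (\<forall>i<r. V i \<subseteq> {..<n} \<and> card (V i) = t) \<and>
        (\<forall>i<r. \<forall>j<r. i \<noteq> j \<longrightarrow> V i \<inter> V j = {}) \<and>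
        (\<forall>i<r. \<forall>j<r. i \<noteq> j \<longrightarrow> (\<forall>u\<in>V i. \<forall>v\<in>V j. E u v)))"

end

theory Submission
  imports Defs "HOL-Analysis.Function_Topology" "HOL-Analysis.Convex" "HOL-Real_Asymp.Real_Asymp"
begin

text \<open>
  Let \<open>q(R)\<close> be the largest signless Laplacian eigenvalue of the subgraph induced on \<open>R\<close>. Choose
  a vertex set \<open>R\<close> maximising \<open>q(R) / |R|\<^sup>1\<^sup>-\<^sup>\<delta>\<close> for a small \<open>\<delta>\<close>. Since \<open>q(R) \<le> 2|R|\<close>, such
  an \<open>R\<close> has linear size, and \<open>q(R) / |R|\<close> is at least \<open>q(G) / n\<close>. If the unit eigenvector \<open>x\<close> of
  \<open>R\<close> had an entry with \<open>x\<^sub>v\<^sup>2\<close> noticeably below \<open>1 / |R|\<close>, deleting \<open>v\<close> would cost less than the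
  factor \<open>((|R| - 1) / |R|)\<^sup>1\<^sup>-\<^sup>\<delta>\<close>; this uses \<open>q(R) > |R|\<close>, that is \<open>k \<ge> 2\<close>. So \<open>x\<close> is
  almost constant and \<open>q(R)\<close> is about twice the average degree of \<open>R\<close>.

  It remains to prove the Erdos-Stone theorem with logarithmic class size. A dense graph has
  a subgraph of linear size and large minimum degree, found by the same kind of extremal choice.
  There a \<open>K\<^sub>j[T]\<close> with \<open>T = c log n\<close> extends to a \<open>K\<^sub>j\<^sub>+\<^sub>1[t]\<close>: a positive proportion of all
  vertices see at least \<open>t\<close> vertices in each class, and they have at most
  \<open>2\<^sup>j\<^sup>T \<le> n\<^sup>1\<^sup>/\<^sup>2\<close> (up to a constant) different traces on it, so \<open>t\<close> of them share a trace.
\<close>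

section \<open>Extending a complete multipartite subgraph\<close>

definition degree_in :: "'a set \<Rightarrow> ('a \<Rightarrow> 'a \<Rightarrow> bool) \<Rightarrow> 'a \<Rightarrow> nat" where
  "degree_in S E u = card {v \<in> S. E u v}"

text \<open>Disjointness of the classes is not demanded: it follows once \<open>E\<close> is irreflexive.\<close>

definition complete_multipartite_in :: "'a set \<Rightarrow> ('a \<Rightarrow> 'a \<Rightarrow> bool) \<Rightarrow> nat \<Rightarrow> nat \<Rightarrow> bool" where
  "complete_multipartite_in S E r t \<longleftrightarrow>
     (\<exists>V. (\<forall>i<r. V i \<subseteq> S \<and> card (V i) = t) \<and>
          (\<forall>i<r. \<forall>j<r. i \<noteq> j \<longrightarrow> (\<forall>u\<in>V i. \<forall>v\<in>V j. E u v)))"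

lemma degree_in_eq_sum:
  "finite S \<Longrightarrow> real (degree_in S E u) = (\<Sum>v\<in>S. of_bool (E u v))"
  unfolding degree_in_def by (simp add: sum.If_cases of_bool_def Int_def)

lemma degree_in_le_card: "finite S \<Longrightarrow> degree_in S E u \<le> card S"
  unfolding degree_in_def by (auto intro: card_mono)

lemma complete_multipartite_in_mono:
  assumes "complete_multipartite_in S E r t" "S \<subseteq> S'" "t' \<le> t"
  shows "complete_multipartite_in S' E r t'"
proof -
  obtain V where V: "\<And>i. i < r \<Longrightarrow> V i \<subseteq> S \<and> card (V i) = t"
    "\<And>i j u v. i < r \<Longrightarrow> j < r \<Longrightarrow> i \<noteq> j \<Longrightarrow> u \<in> V i \<Longrightarrow> v \<in> V j \<Longrightarrow> E u v"
    using assms(1) unfolding complete_multipartite_in_def by blast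
  have "\<exists>W. W \<subseteq> V i \<and> card W = t'" if "i < r" for i
    using V(1)[OF that] assms(3) by (metis obtain_subset_with_card_n)
  then obtain W where W: "\<And>i. i < r \<Longrightarrow> W i \<subseteq> V i \<and> card (W i) = t'"
    by metis
  show ?thesis
    unfolding complete_multipartite_in_def
    using V W assms(2) by (intro exI[of _ W]) blast
qed

lemma pigeonhole_fibre:
  assumes "finite A" "f ` A \<subseteq> B" "finite B" "card B * t < card A"
  shows "\<exists>b\<in>B. t \<le> card {a \<in> A. f a = b}"
proof -
  have "A = (\<Union>b\<in>B. {a \<in> A. f a = b})"
    using assms(2) by auto
  then have "card A \<le> (\<Sum>b\<in>B. card {a \<in> A. f a = b})"
    by (metis card_UN_le assms(3))
  then have "\<not> (\<forall>b\<in>B. card {a \<in> A. f a = b} \<le> t)"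
    using assms(4) sum_bounded_above[of B "\<lambda>b. card {a \<in> A. f a = b}" t] by fastforce
  then show ?thesis
    by (meson linear)
qed

text \<open>Double counting the edges between \<open>S\<close> and the union \<open>K\<close> of the
  classes shows that a proportion \<open>\<epsilon> / 2\<close> of the vertices sees at least
  \<open>\<epsilon> * j * T / 2\<close> vertices of every class. Since \<open>K\<close> has at most
  \<open>2 ^ (j * T)\<close> subsets, \<open>big\<close> forces enough of these vertices to have the
  same neighbourhood in \<open>K\<close>.\<close>

lemma complete_multipartite_in_extend:
  fixes \<epsilon> :: real
  assumes fin: "finite S" and sym: "symp_on S E" and "0 < \<epsilon>" "1 \<le> j" "1 \<le> T"
    and deg: "\<And>u. u \<in> S \<Longrightarrow> (1 - 1 / real j + \<epsilon>) * real (card S) \<le> real (degree_in S E u)"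
    and cm: "complete_multipartite_in S E j T"
    and big: "2 ^ (j * T) * real (nat \<lceil>\<epsilon> * j * T / 2\<rceil>) < \<epsilon> / 2 * real (card S)"
  shows "complete_multipartite_in S E (Suc j) (nat \<lceil>\<epsilon> * j * T / 2\<rceil>)"
proof -
  define n where "n = card S"
  define s where "s = \<epsilon> * j * T / 2"
  define t where "t = nat \<lceil>s\<rceil>"
  have s0: "0 \<le> s" using assms by (simp add: s_def)
  obtain V where V_all: "\<forall>i<j. V i \<subseteq> S \<and> card (V i) = T"
    "\<forall>i<j. \<forall>i'<j. i \<noteq> i' \<longrightarrow> (\<forall>u\<in>V i. \<forall>v\<in>V i'. E u v)"
    using cm unfolding complete_multipartite_in_def by auto
  then have V: "\<And>i. i < j \<Longrightarrow> V i \<subseteq> S" "\<And>i. i < j \<Longrightarrow> card (V i) = T"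
    "\<And>i i' u v. i < j \<Longrightarrow> i' < j \<Longrightarrow> i \<noteq> i' \<Longrightarrow> u \<in> V i \<Longrightarrow> v \<in> V i' \<Longrightarrow> E u v"
    by simp_all
  have finV: "finite (V i)" if "i < j" for i
    using V(1)[OF that] fin finite_subset by blast
  define K where "K = (\<Union>i<j. V i)"
  define h where "h v = (\<Sum>i<j. real (degree_in (V i) E v))" for v
  \<comment> \<open>The average of \<open>h\<close> is at least \<open>(j - 1) * T + 2 * s\<close>;
    half of the surplus is given up. The other \<open>j - 1\<close> classes contribute at most
    \<open>(j - 1) * T\<close>, so a good vertex has \<open>s\<close> neighbours in each
    class.\<close>
  define good where "good = {v \<in> S. real (j - 1) * T + s \<le> h v}"
  have deg_le: "degree_in (V i) E v \<le> T" if "i < j" for i v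
    using degree_in_le_card[OF finV[OF that]] V(2)[OF that] by metis
  have h_le: "h v \<le> real j * T" for v
    using sum_bounded_above[of "{..<j}" "\<lambda>i. real (degree_in (V i) E v)" "real T"] deg_le
    unfolding h_def by simp
  have "(\<Sum>v\<in>S. h v) = (\<Sum>i<j. \<Sum>u\<in>V i. real (degree_in S E u))"
  proof -
    have "(\<Sum>v\<in>S. h v) = (\<Sum>i<j. \<Sum>v\<in>S. \<Sum>u\<in>V i. of_bool (E v u))"
      unfolding h_def by (subst sum.swap) (simp add: degree_in_eq_sum finV)
    also have "\<dots> = (\<Sum>i<j. \<Sum>u\<in>V i. \<Sum>v\<in>S. of_bool (E u v))"
    proof (rule sum.cong[OF refl], subst sum.swap, intro sum.cong refl)
      fix i u v assume "i \<in> {..<j}" "u \<in> V i" "v \<in> S"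
      then have "u \<in> S" using V(1) by blast
      then show "(of_bool (E v u) :: real) = of_bool (E u v)"
        using sym \<open>v \<in> S\<close> by (metis symp_onD of_bool_eq_iff)
    qed
    finally show ?thesis by (simp add: degree_in_eq_sum fin)
  qed
  also have "\<dots> \<ge> (\<Sum>i<j. \<Sum>u\<in>V i. (1 - 1 / real j + \<epsilon>) * real n)"
    using V(1) deg unfolding n_def by (intro sum_mono) blast
  also have "(\<Sum>i<j. \<Sum>u\<in>V i. (1 - 1 / real j + \<epsilon>) * real n) = j * (T * ((1 - 1 / real j + \<epsilon>) * n))"
    using V(2) by simp
  also have "\<dots> = (real (j - 1) * T + 2 * s) * n"
    using \<open>1 \<le> j\<close> by (simp add: s_def field_simps of_nat_diff)
  finally have lower: "(real (j - 1) * T + 2 * s) * n \<le> (\<Sum>v\<in>S. h v)" .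
  \<comment> \<open>Vertices outside \<open>good\<close> stay below the threshold and good ones
    reach at most \<open>j * T\<close>, so the remaining surplus \<open>s * n\<close> has to be paid
    by the good vertices.\<close>
  have "(\<Sum>v\<in>S. h v) \<le> (\<Sum>v\<in>S. (real (j - 1) * T + s) + of_bool (v \<in> good) * (real j * T))"
  proof (rule sum_mono)
    fix v assume "v \<in> S"
    show "h v \<le> (real (j - 1) * T + s) + of_bool (v \<in> good) * (real j * T)"
      using h_le[of v] s0 \<open>v \<in> S\<close> by (auto simp: good_def add_increasing)
  qed
  also have "\<dots> = (real (j - 1) * T + s) * n + card good * (real j * T)"
  proof -
    have "S \<inter> {v. v \<in> good} = good" by (auto simp: good_def)
    then have "(\<Sum>v\<in>S. of_bool (v \<in> good)) = real (card good)"
      using fin by (simp add: of_bool_def sum.If_cases)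
    then show ?thesis
      unfolding sum.distrib sum_distrib_right[symmetric] by (simp add: n_def algebra_simps)
  qed
  finally have "s * n \<le> card good * (real j * T)"
    using lower by (simp add: algebra_simps)
  then have "(real j * T) * (\<epsilon> / 2 * n) \<le> (real j * T) * card good"
    by (simp add: s_def algebra_simps)
  then have "\<epsilon> / 2 * n \<le> card good"
    by (rule mult_left_le_imp_le) (use assms in simp)
  then have "2 ^ (j * T) * real t < card good"
    using big by (simp add: t_def s_def n_def)
  then have many: "2 ^ (j * T) * t < card good"
    by (metis of_nat_less_iff of_nat_mult of_nat_numeral of_nat_power)
  have finK: "finite K" using finV by (auto simp: K_def)
  have "card K \<le> (\<Sum>i<j. card (V i))"
    unfolding K_def by (rule card_UN_le) simp
  then have "card K \<le> j * T" using V(2) by simp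
  then have "card (Pow K) * t < card good"
    using many by (simp add: card_Pow finK)
      (meson le_less_trans mult_le_mono1 one_le_numeral power_increasing)
  moreover have "(\<lambda>v. {u \<in> K. E v u}) ` good \<subseteq> Pow K" by blast
  moreover have "finite good" "finite (Pow K)"
    using fin finK by (auto simp: good_def)
  ultimately have "\<exists>A\<in>Pow K. t \<le> card {v \<in> good. {u \<in> K. E v u} = A}"
    by (intro pigeonhole_fibre)
  then obtain A where A: "A \<subseteq> K" "t \<le> card {v \<in> good. {u \<in> K. E v u} = A}"
    by (elim bexE) (simp add: that)
  obtain W where W: "W \<subseteq> {v \<in> good. {u \<in> K. E v u} = A}" "card W = t"
    using obtain_subset_with_card_n[OF A(2)] that by blast
  have s_le: "s \<le> degree_in (V i) E v" if "v \<in> good" "i < j" for i v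
  proof -
    have "(\<Sum>i'\<in>{..<j} - {i}. real (degree_in (V i') E v)) \<le> real (card ({..<j} - {i})) * T"
      using deg_le by (intro sum_bounded_above) auto
    moreover have "h v = degree_in (V i) E v + (\<Sum>i'\<in>{..<j} - {i}. real (degree_in (V i') E v))"
      unfolding h_def using that(2) by (intro sum.remove) auto
    moreover have "real (j - 1) * T + s \<le> h v" using that(1) by (simp add: good_def)
    ultimately show ?thesis using that(2) by simp
  qed
  have "\<exists>U. U \<subseteq> V i \<inter> A \<and> card U = t" if i: "i < j" for i
  proof (cases "t = 0")
    case False
    \<comment> \<open>Any \<open>w\<close> in \<open>W\<close> has trace exactly \<open>A\<close>,
      so its neighbours in \<open>V i\<close> lie in \<open>A\<close>; as their number is an
      integer, the bound \<open>s\<close> rounds up to \<open>t\<close>.\<close>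
    then obtain w where w: "w \<in> W" using W(2) by fastforce
    then have "{v \<in> V i. E w v} \<subseteq> V i \<inter> A" using W(1) i by (auto simp: K_def)
    moreover have "t \<le> card {v \<in> V i. E w v}"
      using s_le[of w i] w W(1) i unfolding degree_in_def t_def by fastforce
    ultimately show ?thesis by (meson obtain_subset_with_card_n order_trans)
  qed auto
  then obtain U where U: "\<And>i. i < j \<Longrightarrow> U i \<subseteq> V i \<inter> A \<and> card (U i) = t" by metis
  have adj: "E w u \<and> E u w" if "w \<in> W" "u \<in> U i" "i < j" for w u i
  proof -
    have "E w u" using that W(1) U by blast
    moreover have "w \<in> S" using that W(1) by (auto simp: good_def)
    moreover have "u \<in> S" using that U V(1) by blast
    ultimately show ?thesis using sym by (metis symp_onD)
  qed
  have "complete_multipartite_in S E (Suc j) t"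
    unfolding complete_multipartite_in_def
  proof (intro exI[of _ "U(j := W)"] conjI allI impI ballI)
    fix i assume i: "i < Suc j"
    have "W \<subseteq> S" using W(1) by (auto simp: good_def)
    moreover have "U i \<subseteq> S \<and> card (U i) = t" if "i \<noteq> j"
      using U[of i] V(1)[of i] i that by auto
    ultimately show "(U(j := W)) i \<subseteq> S" "card ((U(j := W)) i) = t"
      using W(2) by simp_all
  next
    fix i i' u v
    assume i: "i < Suc j" "i' < Suc j" "i \<noteq> i'" and uv: "u \<in> (U(j := W)) i" "v \<in> (U(j := W)) i'"
    consider "i = j" "i' < j" | "i < j" "i' = j" | "i < j" "i' < j"
      using i by linarith
    then show "E u v"
    proof cases
      case 3
      then have "u \<in> V i" "v \<in> V i'" using uv U by auto
      then show ?thesis using V(3) 3 i(3) by blast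
    qed (use adj uv in auto)
  qed
  then show ?thesis by (simp add: t_def s_def)
qed

text \<open>Induction on the number of classes with \<open>k\<close> fixed: for
  \<open>1 \<le> j \<le> k\<close> the degree condition for \<open>k\<close> implies the one for
  \<open>j\<close>, so every extension step up to \<open>Suc k\<close> classes applies to the same
  graph. Each step changes the logarithmic constant only by a factor depending on \<epsilon>,
  \<open>j\<close> and the cap in \<open>c'\<close>.\<close>

lemma min_degree_imp_complete_multipartite:
  fixes \<epsilon> :: real
  assumes "0 < \<epsilon>" "j \<le> Suc k"
  shows "\<exists>c>0. \<exists>n0. \<forall>(S :: 'a set) E. finite S \<longrightarrow> n0 \<le> card S \<longrightarrow> symp_on S E \<longrightarrow>
    (\<forall>u\<in>S. (1 - 1 / real k + \<epsilon>) * real (card S) \<le> real (degree_in S E u)) \<longrightarrow>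
    (\<exists>t. c * ln (real (card S)) \<le> real t \<and> complete_multipartite_in S E j t)"
  using assms(2)
proof (induction j)
  case 0
  have "\<exists>t. 1 * ln (real (card S)) \<le> real t \<and> complete_multipartite_in S E 0 t"
    for S :: "'a set" and E
    using real_arch_simple by (simp add: complete_multipartite_in_def)
  then show ?case
    by (intro exI[of _ 1]) simp
next
  case (Suc j)
  show ?case
  proof (cases "j = 0")
    case True
    show ?thesis
    proof (rule exI[of _ "1::real"], rule conjI, simp, rule exI[of _ "1::nat"], intro allI impI)
      fix S :: "'a set" and E assume "1 \<le> card S"
      then show "\<exists>t. 1 * ln (real (card S)) \<le> real t \<and> complete_multipartite_in S E (Suc j) t"
        using True ln_le_minus_one[of "real (card S)"]
        by (intro exI[of _ "card S"] conjI)
          (auto simp: complete_multipartite_in_def intro!: exI[of _ "\<lambda>_. S"])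
    qed
  next
    case False
    then have j: "1 \<le> j" "j \<le> k" using Suc.prems by auto
    obtain c n0 where c: "c > 0" and IH: "\<forall>(S :: 'a set) E. finite S \<longrightarrow> n0 \<le> card S \<longrightarrow> symp_on S E \<longrightarrow>
      (\<forall>u\<in>S. (1 - 1 / real k + \<epsilon>) * real (card S) \<le> real (degree_in S E u)) \<longrightarrow>
      (\<exists>t. c * ln (real (card S)) \<le> real t \<and> complete_multipartite_in S E j t)"
      using Suc.IH[OF Suc_leD[OF Suc.prems]] by (elim exE conjE) (rule that)
    \<comment> \<open>The cap \<open>1 / (2 * j)\<close> yields
      \<open>j * T \<le> j + ln n / 2\<close>, so the number of traces is at most
      \<open>2 ^ j * sqrt n\<close>, well below the linear number of good vertices.\<close>
    define c' where "c' = min c (1 / (2 * real j))"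
    have c': "c' > 0" "c' \<le> c" "real j * c' \<le> 1 / 2"
      using c j by (auto simp: c'_def min_def field_simps)
    have "1 * c' \<le> real j * c'"
      using j c'(1) by (intro mult_right_mono) auto
    then have c'1: "c' \<le> 1"
      using c'(3) by linarith
    have "\<forall>\<^sub>F n in at_top. 2 ^ j * sqrt (real n) * (\<epsilon> * real j / 2 * (ln (real n) + 1) + 1) < \<epsilon> / 2 * real n"
      using assms(1) j by real_asymp
    then obtain n1 where n1: "\<And>n. n1 \<le> n \<Longrightarrow>
        2 ^ j * sqrt (real n) * (\<epsilon> * real j / 2 * (ln (real n) + 1) + 1) < \<epsilon> / 2 * real n"
      by (auto simp: eventually_at_top_linorder)
    show ?thesis
    proof (rule exI[of _ "\<epsilon> * j * c' / 2"], rule conjI, use assms(1) j c' in simp,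
        rule exI[of _ "max 2 (max n0 n1)"], intro allI impI)
      fix S :: "'a set" and E
      assume fin: "finite S" and n: "max 2 (max n0 n1) \<le> card S" and sym: "symp_on S E"
        and deg: "\<forall>u\<in>S. (1 - 1 / real k + \<epsilon>) * real (card S) \<le> real (degree_in S E u)"
      \<comment> \<open>The induction hypothesis may supply far larger classes; they are cut down to
        \<open>T\<close> so that the number of traces stays under control.\<close>
      define T where "T = nat \<lceil>c' * ln (real (card S))\<rceil>"
      define n where "n = card S"
      have n2: "n \<ge> 2" and ln0: "ln (real n) > 0" using n by (auto simp: n_def)
      obtain t where t: "c * ln (real n) \<le> real t" "complete_multipartite_in S E j t"
        using IH fin sym deg n unfolding n_def by (metis max.bounded_iff)
      have T_lower: "c' * ln (real n) \<le> T" by (simp add: T_def n_def real_nat_ceiling_ge)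
      then have T1: "1 \<le> T" using c'(1) ln0
        by (metis Suc_leI One_nat_def gr0I mult_pos_pos not_le of_nat_0)
      have T_upper: "T \<le> c' * ln (real n) + 1"
        using c'(1) ln0 ceiling_correct[of "c' * ln (real n)"] by (simp add: T_def n_def)
      have "c' * ln (real n) \<le> t"
        using t(1) c'(2) ln0 by (meson less_imp_le mult_right_mono order_trans)
      then have "T \<le> t" by (simp add: T_def n_def nat_le_iff ceiling_le_iff)
      then have cm: "complete_multipartite_in S E j T"
        using t(2) complete_multipartite_in_mono by blast
      define t' where "t' = nat \<lceil>\<epsilon> * j * T / 2\<rceil>"
      have t'_upper: "t' \<le> \<epsilon> * j / 2 * (ln (real n) + 1) + 1"
      proof -
        have "t' \<le> \<epsilon> * j / 2 * T + 1"
          using ceiling_correct[of "\<epsilon> * j * T / 2"] assms(1) by (simp add: t'_def)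
        moreover have "real T \<le> ln (real n) + 1"
          using T_upper c'1 ln0 mult_right_mono[of c' 1 "ln (real n)"] by linarith
        then have "\<epsilon> * j / 2 * T \<le> \<epsilon> * j / 2 * (ln (real n) + 1)"
          using assms(1) by (intro mult_left_mono) auto
        ultimately show ?thesis by linarith
      qed
      have "real (j * T) \<le> j + 1 / 2 * ln (real n)"
      proof -
        have "real j * T \<le> real j * (c' * ln (real n) + 1)"
          using T_upper by (intro mult_left_mono) auto
        also have "\<dots> = j + (real j * c') * ln (real n)" by (simp add: algebra_simps)
        also have "\<dots> \<le> j + 1 / 2 * ln (real n)"
          using c'(3) ln0 by (intro add_left_mono mult_right_mono) auto
        finally show ?thesis by simp
      qed
      then have "(2::real) powr (real (j * T)) \<le> 2 powr (j + 1 / 2 * ln (real n))"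
        by (intro powr_mono) auto
      also have "\<dots> = 2 ^ j * 2 powr (1 / 2 * ln (real n))"
        by (simp add: powr_add powr_realpow)
      also have "\<dots> \<le> 2 ^ j * exp (1 / 2 * ln (real n))"
      proof -
        have "1 / 2 * ln (real n) * ln 2 \<le> 1 / 2 * ln (real n) * 1"
          using ln0 ln_2_less_1 by (intro mult_left_mono) auto
        then show ?thesis by (simp add: powr_def)
      qed
      also have "exp (1 / 2 * ln (real n)) = sqrt (real n)"
        using n2 powr_half_sqrt[of "real n"] by (simp add: powr_def)
      finally have pow: "(2::real) ^ (j * T) \<le> 2 ^ j * sqrt (real n)"
        by (simp add: powr_realpow del: of_nat_mult)
      have "2 ^ (j * T) * real t' \<le> 2 ^ j * sqrt (real n) * (\<epsilon> * real j / 2 * (ln (real n) + 1) + 1)"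
        using pow t'_upper by (intro mult_mono) auto
      also have "\<dots> < \<epsilon> / 2 * n"
        using n1[of n] n by (simp add: n_def)
      finally have big: "2 ^ (j * T) * real t' < \<epsilon> / 2 * n" .
      have "(1 - 1 / real j + \<epsilon>) * real (card S) \<le> real (degree_in S E u)" if "u \<in> S" for u
      proof -
        have "(1 - 1 / real j + \<epsilon>) * real (card S) \<le> (1 - 1 / real k + \<epsilon>) * real (card S)"
          using j by (intro mult_right_mono) (auto simp: frac_le)
        then show ?thesis using deg that by fastforce
      qed
      then have "complete_multipartite_in S E (Suc j) t'"
        using complete_multipartite_in_extend[OF fin sym assms(1) j(1) T1 _ cm] big
        by (simp add: t'_def n_def)
      moreover have "\<epsilon> * j * c' / 2 * ln (real n) \<le> t'"
      proof -
        have "\<epsilon> * j * c' / 2 * ln (real n) = \<epsilon> * j / 2 * (c' * ln (real n))" by simp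
        also have "\<dots> \<le> \<epsilon> * j / 2 * T"
          using T_lower assms(1) by (intro mult_left_mono) auto
        also have "\<dots> \<le> t'" unfolding t'_def using real_nat_ceiling_ge[of "\<epsilon> * j * T / 2"] by simp
        finally show ?thesis .
      qed
      ultimately show "\<exists>t. \<epsilon> * j * c' / 2 * ln (real (card S)) \<le> real t \<and>
          complete_multipartite_in S E (Suc j) t"
        by (auto simp: n_def)
    qed
  qed
qed

section \<open>The signless Laplacian form\<close>

lemma symp_on_commute: "symp_on S E \<Longrightarrow> i \<in> S \<Longrightarrow> j \<in> S \<Longrightarrow> E i j \<longleftrightarrow> E j i"
  by (blast dest: symp_onD)

lemma sum_edges_swap:
  assumes "symp_on S E"
  shows "(\<Sum>i\<in>S. \<Sum>j\<in>S. of_bool (E i j) * f j i) = (\<Sum>i\<in>S. \<Sum>j\<in>S. of_bool (E i j) * (f i j :: real))"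
proof (subst sum.swap, intro sum.cong refl)
  fix i j assume "i \<in> S" "j \<in> S"
  then show "of_bool (E j i) * f i j = of_bool (E i j) * f i j"
    using symp_on_commute[OF assms] by simp
qed

text \<open>The quadratic form of \<open>D + A\<close>; the factor \<open>1/2\<close> compensates for each edge appearing
  as two ordered pairs.\<close>

definition sl_form :: "'a set \<Rightarrow> ('a \<Rightarrow> 'a \<Rightarrow> bool) \<Rightarrow> ('a \<Rightarrow> real) \<Rightarrow> real" where
  "sl_form S E x = (\<Sum>i\<in>S. \<Sum>j\<in>S. of_bool (E i j) * (x i + x j)\<^sup>2) / 2"

lemma sl_form_cong: "(\<And>i. i \<in> S \<Longrightarrow> x i = y i) \<Longrightarrow> sl_form S E x = sl_form S E y"
  unfolding sl_form_def by simp

lemma sl_form_scale: "sl_form S E (\<lambda>i. c * x i) = c\<^sup>2 * sl_form S E x"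
  unfolding sl_form_def
  by (simp add: distrib_left[symmetric] power_mult_distrib sum_distrib_left mult.left_commute)

text \<open>This is why a maximiser of the form can be chosen nonnegative.\<close>

lemma sl_form_le_abs: "sl_form S E x \<le> sl_form S E (\<lambda>i. \<bar>x i\<bar>)"
  unfolding sl_form_def
proof (intro divide_right_mono sum_mono mult_left_mono)
  fix i j
  have "(\<bar>x i + x j\<bar>)\<^sup>2 \<le> (\<bar>x i\<bar> + \<bar>x j\<bar>)\<^sup>2"
    by (intro power_mono) auto
  then show "(x i + x j)\<^sup>2 \<le> (\<bar>x i\<bar> + \<bar>x j\<bar>)\<^sup>2" by simp
qed auto

text \<open>Apply \<open>(a + b)\<^sup>2 \<le> 2 * a\<^sup>2 + 2 * b\<^sup>2\<close> to each edge.
  Equality holds for constant vectors, so little is lost when the eigenvector is almost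
  constant.\<close>

lemma sl_form_le_degree_sum:
  assumes "finite S" "symp_on S E"
  shows "sl_form S E x \<le> 2 * (\<Sum>i\<in>S. real (degree_in S E i) * (x i)\<^sup>2)"
proof -
  have "(\<Sum>i\<in>S. \<Sum>j\<in>S. of_bool (E i j) * (x i + x j)\<^sup>2)
    \<le> (\<Sum>i\<in>S. \<Sum>j\<in>S. of_bool (E i j) * (2 * (x i)\<^sup>2 + 2 * (x j)\<^sup>2))"
  proof (intro sum_mono mult_left_mono)
    fix i j
    show "(x i + x j)\<^sup>2 \<le> 2 * (x i)\<^sup>2 + 2 * (x j)\<^sup>2"
      using sum_squares_bound[of "x i" "x j"] by (simp add: power2_sum)
  qed auto
  also have "\<dots> = (\<Sum>i\<in>S. \<Sum>j\<in>S. of_bool (E i j) * (2 * (x i)\<^sup>2))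
      + (\<Sum>i\<in>S. \<Sum>j\<in>S. of_bool (E i j) * (2 * (x j)\<^sup>2))"
    by (simp add: sum.distrib distrib_left)
  also have "(\<Sum>i\<in>S. \<Sum>j\<in>S. of_bool (E i j) * (2 * (x j)\<^sup>2))
      = (\<Sum>i\<in>S. \<Sum>j\<in>S. of_bool (E i j) * (2 * (x i)\<^sup>2))"
    by (rule sum_edges_swap[OF assms(2), of "\<lambda>i j. 2 * (x i)\<^sup>2"])
  also have "(\<Sum>i\<in>S. \<Sum>j\<in>S. of_bool (E i j) * (2 * (x i)\<^sup>2))
      = 2 * (\<Sum>i\<in>S. real (degree_in S E i) * (x i)\<^sup>2)"
    using assms(1)
    by (simp add: degree_in_eq_sum sum_distrib_left sum_distrib_right mult_ac
        del: sum_of_bool_mult_eq sum_mult_of_bool_eq sum_of_bool_eq)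
  finally show ?thesis unfolding sl_form_def by simp
qed

lemma sl_form_insert:
  assumes "finite S" "k \<notin> S" "symp_on (insert k S) E" "irreflp_on (insert k S) E"
  shows "sl_form (insert k S) E x = sl_form S E x + (\<Sum>i\<in>S. of_bool (E k i) * (x k + x i)\<^sup>2)"
proof -
  have "(\<Sum>i\<in>S. of_bool (E i k) * (x i + x k)\<^sup>2) = (\<Sum>i\<in>S. of_bool (E k i) * (x k + x i)\<^sup>2)"
    using symp_on_commute[OF assms(3), of k] by (intro sum.cong refl) (simp add: add.commute)
  moreover have "\<not> E k k" using assms(4) by (simp add: irreflp_on_def)
  ultimately show ?thesis
    unfolding sl_form_def using assms(1,2)
    by (simp add: sum.distrib add_divide_distrib del: sum_of_bool_mult_eq sum_mult_of_bool_eq)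
qed

text \<open>The right-hand side is the inner product of \<open>x\<close> with
  \<open>(D + A) x\<close>. Splitting one factor of the square gives two sums that agree by
  symmetry, which cancels the \<open>1/2\<close>.\<close>

lemma sl_form_eq_bilinear:
  assumes "symp_on S E"
  shows "sl_form S E x = (\<Sum>i\<in>S. x i * (\<Sum>j\<in>S. of_bool (E i j) * (x i + x j)))"
proof -
  have "(\<Sum>i\<in>S. \<Sum>j\<in>S. of_bool (E i j) * (x i + x j)\<^sup>2)
    = (\<Sum>i\<in>S. \<Sum>j\<in>S. of_bool (E i j) * (x i * (x i + x j)))
      + (\<Sum>i\<in>S. \<Sum>j\<in>S. of_bool (E i j) * (x j * (x i + x j)))"
    by (simp add: sum.distrib[symmetric] algebra_simps power2_eq_square)
  also have "(\<Sum>i\<in>S. \<Sum>j\<in>S. of_bool (E i j) * (x j * (x i + x j)))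
      = (\<Sum>i\<in>S. \<Sum>j\<in>S. of_bool (E i j) * (x i * (x i + x j)))"
    using sum_edges_swap[OF assms, of "\<lambda>i j. x i * (x i + x j)"] by (simp add: add.commute)
  also have "(\<Sum>i\<in>S. \<Sum>j\<in>S. of_bool (E i j) * (x i * (x i + x j)))
      = (\<Sum>i\<in>S. x i * (\<Sum>j\<in>S. of_bool (E i j) * (x i + x j)))"
    unfolding sum_distrib_left by (simp only: mult.left_commute)
  finally show ?thesis
    unfolding sl_form_def by linarith
qed

section \<open>The principal value and a nonnegative unit eigenvector\<close>

text \<open>The Rayleigh quotient description of the largest eigenvalue of \<open>D + A\<close>.
  Being free of matrices, it applies directly to induced subgraphs on arbitrary finite vertex sets;
  the eigenvector equation is derived from it.\<close>

definition is_principal_pair ::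
  "'a set \<Rightarrow> ('a \<Rightarrow> 'a \<Rightarrow> bool) \<Rightarrow> real \<Rightarrow> ('a \<Rightarrow> real) \<Rightarrow> bool" where
  "is_principal_pair S E \<mu> x \<longleftrightarrow>
     (\<forall>i. 0 \<le> x i) \<and> (\<Sum>i\<in>S. (x i)\<^sup>2) = 1 \<and> sl_form S E x = \<mu> \<and>
     (\<forall>y. sl_form S E y \<le> \<mu> * (\<Sum>i\<in>S. (y i)\<^sup>2))"

text \<open>The form is continuous on the compact nonnegative part of the unit sphere, so it has a
  maximiser there; replacing \<open>y\<close> by its normalised absolute value carries the bound
  over to all \<open>y\<close>.\<close>

lemma principal_pair_exists:
  fixes S :: "'a set"
  assumes "finite S" "S \<noteq> {}"
  shows "\<exists>\<mu> x. is_principal_pair S E \<mu> x"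
proof -
  \<comment> \<open>Coordinates outside \<open>S\<close> are pinned to 0, so this product is compact
    even if the vertex type is infinite.\<close>
  define C where "C = PiE UNIV (\<lambda>i. if i \<in> S then {0..1::real} else {0})
    \<inter> {x. (\<Sum>i\<in>S. (x i)\<^sup>2) = 1}"
  have "compact (PiE UNIV (\<lambda>i::'a. if i \<in> S then {0..1::real} else {0}))"
  proof -
    have "compactin (product_topology (\<lambda>i::'a. euclidean :: real topology) UNIV)
       (PiE UNIV (\<lambda>i. if i \<in> S then {0..1} else {0}))"
      unfolding compactin_PiE by auto
    then show ?thesis by (simp add: euclidean_product_topology)
  qed
  moreover have "closed {x :: 'a \<Rightarrow> real. (\<Sum>i\<in>S. (x i)\<^sup>2) = 1}"
    by (intro closed_Collect_eq continuous_intros continuous_on_product_coordinates)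
  ultimately have "compact C" unfolding C_def by (rule compact_Int_closed)
  have normalize: "\<exists>z\<in>C. sl_form S E y \<le> sl_form S E z * (\<Sum>i\<in>S. (y i)\<^sup>2)"
    if pos: "(\<Sum>i\<in>S. (y i)\<^sup>2) > 0" for y
  proof (intro bexI)
    let ?N = "\<Sum>i\<in>S. (y i)\<^sup>2"
    define z where "z i = (if i \<in> S then 1 / sqrt ?N * \<bar>y i\<bar> else 0)" for i
    have "sl_form S E z = (1 / sqrt ?N)\<^sup>2 * sl_form S E (\<lambda>i. \<bar>y i\<bar>)"
      unfolding sl_form_scale[symmetric] by (rule sl_form_cong) (simp add: z_def)
    then have "sl_form S E z * ?N = sl_form S E (\<lambda>i. \<bar>y i\<bar>)"
      using pos by (simp add: power_divide)
    then show "sl_form S E y \<le> sl_form S E z * ?N"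
      using sl_form_le_abs by metis
    have sum1: "(\<Sum>i\<in>S. (z i)\<^sup>2) = 1"
      using pos by (simp add: z_def power_divide power_mult_distrib sum_divide_distrib[symmetric])
    moreover have "z i \<in> {0..1}" if "i \<in> S" for i
    proof -
      have "(z i)\<^sup>2 \<le> 1"
        using sum1 member_le_sum[OF that, of "\<lambda>i. (z i)\<^sup>2"] assms(1) by simp
      moreover have "0 \<le> z i" using pos by (simp add: z_def)
      ultimately show ?thesis by (simp add: power2_le_iff_abs_le abs_le_iff power_le_one_iff)
    qed
    ultimately show "z \<in> C" by (auto simp: C_def z_def)
  qed
  have "C \<noteq> {}"
  proof -
    have "(\<Sum>i\<in>S. (1::real)\<^sup>2) > 0" using assms by (simp add: card_gt_0_iff)
    from normalize[OF this] show ?thesis by blast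
  qed
  moreover have "continuous_on C (sl_form S E)"
    unfolding sl_form_def
    by (intro continuous_intros continuous_on_subset[OF continuous_on_product_coordinates]) auto
  ultimately obtain x where x: "x \<in> C" "\<forall>z\<in>C. sl_form S E z \<le> sl_form S E x"
    using continuous_attains_sup[OF \<open>compact C\<close>] by blast
  have "sl_form S E y \<le> sl_form S E x * (\<Sum>i\<in>S. (y i)\<^sup>2)" for y
  proof (cases "(\<Sum>i\<in>S. (y i)\<^sup>2) > 0")
    case True
    then obtain z where "z \<in> C" "sl_form S E y \<le> sl_form S E z * (\<Sum>i\<in>S. (y i)\<^sup>2)"
      using normalize by blast
    then show ?thesis
      using x(2) True by (meson less_imp_le mult_right_mono order_trans)
  next
    case False
    then have "(\<Sum>i\<in>S. (y i)\<^sup>2) = 0" by (simp add: order_antisym sum_nonneg not_less)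
    then have "\<forall>i\<in>S. y i = 0" using assms(1) by (simp add: sum_nonneg_eq_0_iff)
    then have "sl_form S E y = sl_form S E (\<lambda>i. 0 * y i)" by (intro sl_form_cong) simp
    then have "sl_form S E y = 0" unfolding sl_form_scale by simp
    then show ?thesis using \<open>(\<Sum>i\<in>S. (y i)\<^sup>2) = 0\<close> by simp
  qed
  moreover have "(\<Sum>i\<in>S. (x i)\<^sup>2) = 1" using x(1) by (simp add: C_def)
  moreover have "0 \<le> x i" for i
  proof -
    have "x i \<in> (if i \<in> S then {0..1} else {0})"
      using x(1) unfolding C_def by (simp add: PiE_iff)
    then show ?thesis by (auto split: if_splits)
  qed
  ultimately show ?thesis unfolding is_principal_pair_def by blast
qed

text \<open>A first-order condition without derivatives: a nonzero linear term beats any quadratic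
  term for small \<open>t\<close> of the right sign.\<close>

lemma linear_coeff_zero:
  fixes a b :: real
  assumes "\<And>t. 2 * t * a \<le> t\<^sup>2 * b"
  shows "a = 0"
proof -
  \<comment> \<open>A positive \<open>d\<close> above \<open>b\<close> makes
    \<open>t = a / d\<close> small enough: the hypothesis becomes
    \<open>2 * a\<^sup>2 * d \<le> a\<^sup>2 * b\<close>, which is at most
    \<open>a\<^sup>2 * d\<close>.\<close>
  define d where "d = \<bar>b\<bar> + 1"
  have d: "d > 0" "b < d" by (auto simp: d_def)
  have "2 * (a / d) * a \<le> (a / d)\<^sup>2 * b" by (rule assms)
  then have "2 * a\<^sup>2 * d \<le> a\<^sup>2 * b"
    using d by (simp add: field_simps power2_eq_square)
  moreover have "a\<^sup>2 * b \<le> a\<^sup>2 * d" using d by (intro mult_left_mono) auto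
  ultimately have "a\<^sup>2 * d \<le> 0" by simp
  then show ?thesis using d by (simp add: mult_le_0_iff)
qed

text \<open>Perturbing coordinate \<open>k\<close> by \<open>t\<close> changes both the form and the
  squared norm by a quadratic polynomial in \<open>t\<close>; maximality forces the linear
  coefficients to match.\<close>

lemma principal_pair_eigen_equation:
  assumes "finite S" "symp_on S E" "irreflp_on S E" "is_principal_pair S E \<mu> x" "k \<in> S"
  shows "(\<Sum>i\<in>S. of_bool (E k i) * (x k + x i)) = \<mu> * x k"
proof -
  define R where "R = S - {k}"
  have R: "finite R" "k \<notin> R" "S = insert k R" using assms by (auto simp: R_def)
  define a where "a = (\<Sum>i\<in>R. of_bool (E k i) * (x k + x i))"
  define d where "d = (\<Sum>i\<in>R. of_bool (E k i) :: real)"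
  have ins: "sl_form S E y = sl_form R E y + (\<Sum>i\<in>R. of_bool (E k i) * (y k + y i)\<^sup>2)" for y
    unfolding R(3) using R assms(2,3) by (intro sl_form_insert) auto
  have "2 * t * (a - \<mu> * x k) \<le> t\<^sup>2 * (\<mu> - d)" for t
  proof -
    define y where "y = x(k := x k + t)"
    have "(\<Sum>i\<in>R. of_bool (E k i) * (y k + y i)\<^sup>2)
      = (\<Sum>i\<in>R. of_bool (E k i) * (x k + x i)\<^sup>2 + 2 * t * (of_bool (E k i) * (x k + x i))
          + t\<^sup>2 * of_bool (E k i))"
      using R(2) by (intro sum.cong refl) (auto simp: y_def power2_eq_square algebra_simps)
    also have "\<dots> = (\<Sum>i\<in>R. of_bool (E k i) * (x k + x i)\<^sup>2) + 2 * t * a + t\<^sup>2 * d"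
      by (simp add: sum.distrib sum_distrib_left a_def d_def)
    moreover have "sl_form R E y = sl_form R E x"
      using R(2) by (intro sl_form_cong) (auto simp: y_def)
    ultimately have "sl_form S E y = sl_form S E x + 2 * t * a + t\<^sup>2 * d"
      unfolding ins by simp
    moreover have "(\<Sum>i\<in>S. (y i)\<^sup>2) = (\<Sum>i\<in>S. (x i)\<^sup>2) + 2 * t * x k + t\<^sup>2"
    proof -
      have "(\<Sum>i\<in>R. (y i)\<^sup>2) = (\<Sum>i\<in>R. (x i)\<^sup>2)"
        using R(2) by (intro sum.cong) (auto simp: y_def)
      then show ?thesis
        unfolding R(3) using R(1,2) by (simp add: y_def power2_eq_square algebra_simps)
    qed
    ultimately have "\<mu> + 2 * t * a + t\<^sup>2 * d \<le> \<mu> * (1 + 2 * t * x k + t\<^sup>2)"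
      using assms(4) unfolding is_principal_pair_def by metis
    then show ?thesis by (simp add: algebra_simps)
  qed
  then have "a = \<mu> * x k" using linear_coeff_zero by fastforce
  moreover have "\<not> E k k" using assms(3,5) by (simp add: irreflp_on_def)
  ultimately show ?thesis unfolding R(3) using R(1,2) by (simp add: a_def)
qed

section \<open>The principal value, degrees and vertex deletion\<close>

lemma principal_value_le:
  assumes "finite S" "symp_on S E" "is_principal_pair S E \<mu> x"
  shows "\<mu> \<le> 2 * real (card S)"
proof -
  have "\<mu> \<le> 2 * (\<Sum>i\<in>S. real (degree_in S E i) * (x i)\<^sup>2)"
    using sl_form_le_degree_sum[OF assms(1,2), of x] assms(3) by (simp add: is_principal_pair_def)
  also have "\<dots> \<le> 2 * (\<Sum>i\<in>S. real (card S) * (x i)\<^sup>2)"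
    using assms(1) by (intro mult_left_mono sum_mono mult_right_mono)
      (auto simp: degree_in_def intro: card_mono)
  also have "\<dots> = 2 * real (card S)"
    using assms(3) by (simp add: is_principal_pair_def sum_distrib_left[symmetric])
  finally show ?thesis .
qed

text \<open>The eigenvector equation at \<open>k\<close> evaluates the lost energy; minimality of \<open>x k\<close>
  bounds the neighbour sum by the sum over all of \<open>S\<close>.\<close>

lemma principal_value_delete_min:
  assumes "finite S" "symp_on S E" "irreflp_on S E" "is_principal_pair S E \<mu> x"
    and "k \<in> S" "\<And>i. i \<in> S \<Longrightarrow> x k \<le> x i" "is_principal_pair (S - {k}) E \<mu>' x'"
  shows "\<mu> - 1 + real (card S) * (x k)\<^sup>2 - 2 * \<mu> * (x k)\<^sup>2 \<le> \<mu>' * (1 - (x k)\<^sup>2)"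
proof -
  define R where "R = S - {k}"
  have R: "finite R" "k \<notin> R" "S = insert k R" using assms by (auto simp: R_def)
  have x: "\<And>i. 0 \<le> x i" "(\<Sum>i\<in>S. (x i)\<^sup>2) = 1" "sl_form S E x = \<mu>"
    using assms(4) by (auto simp: is_principal_pair_def)
  have "\<not> E k k" using assms(3,5) by (simp add: irreflp_on_def)
  then have "(\<Sum>i\<in>R. of_bool (E k i) * (x k + x i)\<^sup>2) = (\<Sum>i\<in>S. of_bool (E k i) * (x k + x i)\<^sup>2)"
    unfolding R(3) using R(1,2) by simp
  \<comment> \<open>The split isolates a multiple of \<open>x k + x i\<close>, whose sum over the
    neighbours of \<open>k\<close> is known from the eigenvector equation.\<close>
  also have "\<dots> = (\<Sum>i\<in>S. of_bool (E k i) * ((x i)\<^sup>2 - (x k)\<^sup>2)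
      + 2 * x k * (of_bool (E k i) * (x k + x i)))"
    by (intro sum.cong refl) (simp add: power2_eq_square algebra_simps)
  also have "\<dots> = (\<Sum>i\<in>S. of_bool (E k i) * ((x i)\<^sup>2 - (x k)\<^sup>2)) + 2 * x k * (\<mu> * x k)"
    unfolding sum.distrib sum_distrib_left[symmetric]
      principal_pair_eigen_equation[OF assms(1-5)] ..
  also have "(\<Sum>i\<in>S. of_bool (E k i) * ((x i)\<^sup>2 - (x k)\<^sup>2)) \<le> (\<Sum>i\<in>S. (x i)\<^sup>2 - (x k)\<^sup>2)"
    using assms(6) x(1) by (intro sum_mono) (auto simp: power_mono)
  also have "\<dots> = 1 - real (card S) * (x k)\<^sup>2"
    using x(2) by (simp add: sum_subtractf)
  finally have "(\<Sum>i\<in>R. of_bool (E k i) * (x k + x i)\<^sup>2)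
      \<le> 1 - real (card S) * (x k)\<^sup>2 + 2 * \<mu> * (x k)\<^sup>2"
    by (simp add: power2_eq_square mult_ac)
  moreover have "sl_form S E x = sl_form R E x + (\<Sum>i\<in>R. of_bool (E k i) * (x k + x i)\<^sup>2)"
    unfolding R(3) using R assms(2,3) by (intro sl_form_insert) auto
  moreover have "sl_form R E x \<le> \<mu>' * (\<Sum>i\<in>R. (x i)\<^sup>2)"
    using assms(7) by (simp add: is_principal_pair_def R_def)
  moreover have "(\<Sum>i\<in>R. (x i)\<^sup>2) = 1 - (x k)\<^sup>2"
    using x(2) R(1,2) unfolding R(3) by simp
  ultimately show ?thesis using x(3) by simp
qed

text \<open>Write \<open>(x i)\<^sup>2\<close> as \<theta> plus an excess. The excesses sum to
  \<open>1 - card S * \<theta>\<close> and are charged at the maximal possible degree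
  \<open>card S\<close>. For \<theta> close to \<open>1 / card S\<close>, the principal value is
  thus at most about twice the average degree.\<close>

lemma principal_pair_degree_sum:
  assumes "finite S" "symp_on S E" "is_principal_pair S E \<mu> x" "0 \<le> \<theta>"
    "\<And>i. i \<in> S \<Longrightarrow> \<theta> \<le> (x i)\<^sup>2"
  shows "\<mu> \<le> 2 * \<theta> * (\<Sum>i\<in>S. real (degree_in S E i)) + 2 * real (card S) * (1 - real (card S) * \<theta>)"
proof -
  have "\<mu> \<le> 2 * (\<Sum>i\<in>S. real (degree_in S E i) * (x i)\<^sup>2)"
    using sl_form_le_degree_sum[OF assms(1,2), of x] assms(3) by (simp add: is_principal_pair_def)
  also have "(\<Sum>i\<in>S. real (degree_in S E i) * (x i)\<^sup>2)
      = (\<Sum>i\<in>S. \<theta> * real (degree_in S E i) + real (degree_in S E i) * ((x i)\<^sup>2 - \<theta>))"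
    by (intro sum.cong refl) (simp add: algebra_simps)
  also have "\<dots> \<le> (\<Sum>i\<in>S. \<theta> * real (degree_in S E i) + real (card S) * ((x i)\<^sup>2 - \<theta>))"
    using assms(1,5) by (intro sum_mono add_left_mono mult_right_mono)
      (auto simp: degree_in_def intro: card_mono)
  also have "\<dots> = \<theta> * (\<Sum>i\<in>S. real (degree_in S E i)) + real (card S) * (1 - real (card S) * \<theta>)"
    using assms(3) unfolding is_principal_pair_def
    by (simp add: sum.distrib sum_distrib_left[symmetric] sum_subtractf)
  finally show ?thesis by (simp add: algebra_simps)
qed

section \<open>From edge density to logarithmic blowups\<close>

text \<open>The form at the constant vector 1 is twice the degree sum, so this is a case of
  \<open>sl_form_insert\<close>, where each new edge contributes 4.\<close>

lemma degree_sum_insert: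
  assumes "finite S" "k \<notin> S" "symp_on (insert k S) E" "irreflp_on (insert k S) E"
  shows "(\<Sum>u\<in>insert k S. real (degree_in (insert k S) E u))
    = (\<Sum>u\<in>S. real (degree_in S E u)) + 2 * real (degree_in (insert k S) E k)"
proof -
  have form_one: "sl_form R E (\<lambda>_. 1) = 2 * (\<Sum>u\<in>R. real (degree_in R E u))" if "finite R" for R
    unfolding sl_form_def
    by (simp add: degree_in_eq_sum[OF that] sum_distrib_left[symmetric] sum_distrib_right[symmetric]
        del: sum_of_bool_mult_eq sum_mult_of_bool_eq sum_of_bool_eq)
  have "\<not> E k k" using assms(4) by (simp add: irreflp_on_def)
  then have deg_k: "real (degree_in (insert k S) E k) = (\<Sum>i\<in>S. of_bool (E k i))"
    using assms(1,2) by (simp add: degree_in_eq_sum del: sum_of_bool_eq)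
  have "(\<Sum>i\<in>S. of_bool (E k i) * (1 + 1 :: real)\<^sup>2) = 4 * real (degree_in (insert k S) E k)"
    unfolding deg_k sum_distrib_right[symmetric] by simp
  then show ?thesis
    using sl_form_insert[OF assms, of "\<lambda>_. 1"] assms(1) by (simp add: form_one)
qed

lemma degree_sum_le: "finite S \<Longrightarrow> (\<Sum>u\<in>S. real (degree_in S E u)) \<le> (real (card S))\<^sup>2"
  using sum_bounded_above[of S "\<lambda>u. real (degree_in S E u)" "real (card S)"] degree_in_le_card
  by (fastforce simp: power2_eq_square)

text \<open>Passing to a subgraph of linear size keeps any size threshold and costs at most a factor
  2 in the logarithm.\<close>

lemma eventually_linear_large:
  fixes \<kappa> N :: real
  assumes "0 < \<kappa>"
  shows "\<forall>\<^sub>F n in sequentially. N \<le> \<kappa> * real n \<and> ln (real n) / 2 \<le> ln (\<kappa> * real n)"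
  using assms by (intro eventually_conj; real_asymp)

lemma finite_maximizer:
  fixes f :: "'b \<Rightarrow> real"
  assumes "finite A" "A \<noteq> {}"
  obtains a where "a \<in> A" "\<And>b. b \<in> A \<Longrightarrow> f b \<le> f a"
proof -
  have "Max (f ` A) \<in> f ` A" using assms by (intro Max_in) auto
  then obtain a where "a \<in> A" "f a = Max (f ` A)" by force
  then show ?thesis using that assms by (metis Max_ge finite_imageI imageI)
qed

text \<open>Take a vertex set maximising the degree sum minus \<open>b\<close> times the squared
  size. Deleting a vertex does not increase this quantity, so every degree in the set is at least
  about \<open>b\<close> times its size.\<close>

lemma edge_density_imp_complete_multipartite:
  fixes \<epsilon> :: real
  assumes "0 < \<epsilon>" "1 \<le> k"
  shows "\<exists>c>0. \<exists>n0. \<forall>(S :: 'a set) E. finite S \<longrightarrow> n0 \<le> card S \<longrightarrow> symp_on S E \<longrightarrow> irreflp_on S E \<longrightarrow>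
    (1 - 1 / real k + \<epsilon>) * (real (card S))\<^sup>2 \<le> (\<Sum>u\<in>S. real (degree_in S E u)) \<longrightarrow>
    (\<exists>t. c * ln (real (card S)) \<le> real t \<and> complete_multipartite_in S E (Suc k) t)"
proof -
  have "0 < \<epsilon> / 4" using assms(1) by simp
  from min_degree_imp_complete_multipartite[OF this order_refl, where 'a = 'a and k = k]
  obtain c n0 where c: "c > 0" and min_deg: "\<forall>(S :: 'a set) E. finite S \<longrightarrow> n0 \<le> card S \<longrightarrow> symp_on S E \<longrightarrow>
    (\<forall>u\<in>S. (1 - 1 / real k + \<epsilon> / 4) * real (card S) \<le> real (degree_in S E u)) \<longrightarrow>
    (\<exists>t. c * ln (real (card S)) \<le> real t \<and> complete_multipartite_in S E (Suc k) t)"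
    by (elim exE conjE) (rule that)
  \<comment> \<open>Half of the surplus density goes into \<open>b\<close>; the other half gives
    \<open>S\<close> the value \<open>\<epsilon> / 2 * n\<^sup>2\<close>, which makes the maximiser
    at least \<kappa> times as large as \<open>S\<close>.\<close>
  define b where "b = 1 - 1 / real k + \<epsilon> / 2"
  have b: "0 \<le> b" "b \<le> 1 + \<epsilon> / 2" using assms by (auto simp: b_def)
  define \<kappa> where "\<kappa> = sqrt (\<epsilon> / 2)"
  have \<kappa>: "0 < \<kappa>" using assms by (simp add: \<kappa>_def)
  \<comment> \<open>The threshold \<open>2 / \<epsilon> + 1\<close> absorbs the error
    \<open>b / 2\<close> of the deletion argument into \<open>\<epsilon> / 4 * m\<close>.\<close>
  from eventually_linear_large[OF \<kappa>, of "max (real n0) (2 / \<epsilon> + 1)"]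
  obtain n1 where n1: "\<And>n. n1 \<le> n \<Longrightarrow>
      max (real n0) (2 / \<epsilon> + 1) \<le> \<kappa> * real n \<and> ln (real n) / 2 \<le> ln (\<kappa> * real n)"
    unfolding eventually_sequentially by blast
  show ?thesis
  proof (rule exI[of _ "c / 2"], rule conjI, use c in simp, rule exI[of _ n1], intro allI impI)
    fix S :: "'a set" and E
    assume fin: "finite S" and n: "n1 \<le> card S" and sym: "symp_on S E" and irr: "irreflp_on S E"
      and dens: "(1 - 1 / real k + \<epsilon>) * (real (card S))\<^sup>2 \<le> (\<Sum>u\<in>S. real (degree_in S E u))"
    define f where "f R = (\<Sum>u\<in>R. real (degree_in R E u)) - b * (real (card R))\<^sup>2" for R
    obtain R where "R \<in> Pow S" and max: "\<And>R'. R' \<in> Pow S \<Longrightarrow> f R' \<le> f R"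
      using finite_maximizer[of "Pow S" f] fin by blast
    then have R: "R \<subseteq> S" "finite R" "symp_on R E" "irreflp_on R E"
      using finite_subset[OF _ fin] symp_on_subset[OF sym] irreflp_on_subset[OF irr] by simp_all
    define m where "m = real (card R)"
    have "\<epsilon> / 2 * (real (card S))\<^sup>2 \<le> f S"
      using dens by (simp add: f_def b_def algebra_simps)
    also have "\<dots> \<le> f R" by (rule max) simp
    also have "\<dots> \<le> m\<^sup>2"
      using degree_sum_le[OF R(2), of E] b(1) unfolding f_def m_def
      by (smt (verit) zero_le_power2 mult_nonneg_nonneg)
    finally have "sqrt (\<epsilon> / 2 * (real (card S))\<^sup>2) \<le> sqrt (m\<^sup>2)"
      by (rule real_sqrt_le_mono)
    then have m: "\<kappa> * real (card S) \<le> m"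
      unfolding \<kappa>_def real_sqrt_mult by (simp add: m_def)
    have m_big: "real n0 \<le> m" "2 / \<epsilon> + 1 \<le> m" using n1[OF n] m by linarith+
    have "(1 - 1 / real k + \<epsilon> / 4) * m \<le> real (degree_in R E v)" if v: "v \<in> R" for v
    proof -
      have ins: "R = insert v (R - {v})" using v by blast
      have "(\<Sum>u\<in>R. real (degree_in R E u))
          = (\<Sum>u\<in>R - {v}. real (degree_in (R - {v}) E u)) + 2 * real (degree_in R E v)"
        using degree_sum_insert[of "R - {v}" v E] R(2-4) ins by simp
      moreover have "real (card (R - {v})) = m - 1"
        using v R(2) by (simp add: m_def card_Diff_singleton) (metis One_nat_def Suc_leI card_gt_0_iff empty_iff of_nat_1 of_nat_diff)
      moreover have "f (R - {v}) \<le> f R" using max R(1) by blast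
      \<comment> \<open>Deleting \<open>v\<close> lowers the degree sum by twice the degree of
        \<open>v\<close>, while the penalty drops by \<open>b * (2 * m - 1)\<close>.\<close>
      ultimately have "b * m\<^sup>2 - b * (m - 1)\<^sup>2 \<le> 2 * real (degree_in R E v)"
        unfolding f_def m_def[symmetric] by simp
      then have "b * m - b / 2 \<le> real (degree_in R E v)"
        by (simp add: power2_eq_square algebra_simps)
      moreover have "b / 2 \<le> \<epsilon> / 4 * m"
        using b(2) m_big(2) assms(1) by (simp add: field_simps)
      moreover have "(1 - 1 / real k + \<epsilon> / 4) * m = b * m - \<epsilon> / 4 * m"
        by (simp add: b_def algebra_simps)
      ultimately show ?thesis by linarith
    qed
    then obtain t where t: "c * ln m \<le> real t" "complete_multipartite_in R E (Suc k) t"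
      using min_deg[rule_format, of R E] R(2,3) m_big(1) by (auto simp: m_def)
    have "c / 2 * ln (real (card S)) \<le> c * ln m"
    proof -
      have "0 < \<kappa> * real (card S)" using n1[OF n] assms(1)
        by (smt (verit) divide_pos_pos)
      then have "ln (\<kappa> * real (card S)) \<le> ln m" using m by simp
      then have "ln (real (card S)) / 2 \<le> ln m" using n1[OF n] by linarith
      then show ?thesis using c mult_left_mono[of "ln (real (card S)) / 2" "ln m" c] by simp
    qed
    then show "\<exists>t. c / 2 * ln (real (card S)) \<le> real t \<and> complete_multipartite_in S E (Suc k) t"
      using t R(1) complete_multipartite_in_mono by (meson order_trans order_refl)
  qed
qed

section \<open>From the principal value to edge density\<close>

text \<open>Weighted AM-GM for \<open>1 - u\<close> and \<open>1\<close> with weights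
  \<open>a\<close> and \<open>1 - a\<close>.\<close>

lemma Bernoulli_powr_le:
  fixes u a :: real
  assumes "0 < u" "u < 1" "0 < a" "a < 1"
  shows "(1 - u) powr a \<le> 1 - a * u"
  using Youngs_inequality_0[of a "1 - a" "1 - u" 1] assms by (simp add: algebra_simps)

text \<open>With \<open>\<gamma> = \<mu> / m\<close> the hypotheses say
  \<open>\<gamma> (1 - \<delta>) (1 - \<theta>) \<le> 1 + m \<theta> (\<gamma> - 1)\<close>, and \<open>\<gamma> - 1\<close> is bounded away from \<open>0\<close>.\<close>

lemma near_uniform_estimate:
  fixes \<mu> \<mu>' m \<theta> \<delta> \<epsilon> :: real
  assumes del: "\<mu> - 1 + m * \<theta> - 2 * \<mu> * \<theta> \<le> \<mu>' * (1 - \<theta>)"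
    and extr: "\<mu>' \<le> \<mu> * (1 - (1 - \<delta>) / m)"
    and "0 \<le> \<theta>" "m * \<theta> \<le> 1" "1 \<le> m" "(1 + 2 * \<epsilon>) * m \<le> \<mu>" "\<mu> \<le> 2 * m"
    and "0 < \<epsilon>" "\<delta> = \<epsilon>\<^sup>2 / 4" "4 / \<epsilon>\<^sup>2 \<le> m"
  shows "1 - m * \<theta> \<le> \<epsilon> / 2"
proof -
  define \<gamma> where "\<gamma> = \<mu> / m"
  have \<mu>: "\<mu> = \<gamma> * m" using assms(5) by (simp add: \<gamma>_def)
  have \<gamma>: "1 + 2 * \<epsilon> \<le> \<gamma>" "\<gamma> \<le> 2" using assms(5-7) by (simp_all add: \<gamma>_def field_simps)
  have \<theta>: "\<theta> \<le> 1 / m" using assms(4,5) by (simp add: field_simps)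
  then have \<theta>1: "\<theta> \<le> 1" using assms(5) by (smt (verit) divide_le_eq_1_pos)
  have \<delta>: "0 < \<delta>" unfolding assms(9) using assms(8) by simp
  have "\<mu> - 1 + m * \<theta> - 2 * \<mu> * \<theta> \<le> \<mu> * (1 - (1 - \<delta>) / m) * (1 - \<theta>)"
    using del extr \<theta>1 mult_right_mono[of \<mu>' "\<mu> * (1 - (1 - \<delta>) / m)" "1 - \<theta>"] by linarith
  also have "\<dots> = \<mu> - \<mu> * \<theta> - \<gamma> * (1 - \<delta>) * (1 - \<theta>)"
    using assms(5) by (simp add: \<mu> field_simps)
  finally have "\<gamma> * (1 - \<delta>) * (1 - \<theta>) \<le> 1 + m * \<theta> * (\<gamma> - 1)"
    by (simp add: \<mu> algebra_simps)
  moreover have "\<gamma> - 2 * \<delta> - 2 * \<theta> \<le> \<gamma> * (1 - \<delta>) * (1 - \<theta>)"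
  proof -
    have "\<gamma> * \<delta> \<le> 2 * \<delta>" "\<gamma> * \<theta> \<le> 2 * \<theta>" "0 \<le> \<gamma> * (\<delta> * \<theta>)"
      using \<gamma> \<delta> assms(3,8) by (auto intro!: mult_right_mono mult_nonneg_nonneg)
    then show ?thesis by (simp add: algebra_simps)
  qed
  \<comment> \<open>Both terms on the right are at most \<open>\<epsilon>\<^sup>2 / 2\<close>, by
    the choice of \<delta> and since \<open>\<theta> \<le> 1 / m\<close>; dividing by
    \<open>\<gamma> - 1 \<ge> 2 * \<epsilon>\<close> leaves \<open>\<epsilon> / 2\<close>.\<close>
  ultimately have "(\<gamma> - 1) * (1 - m * \<theta>) \<le> 2 * \<delta> + 2 * \<theta>"
    by (simp add: algebra_simps)
  also have "2 * \<theta> \<le> \<epsilon>\<^sup>2 / 2"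
  proof -
    have "1 / m \<le> \<epsilon>\<^sup>2 / 4" using assms(5,8,10) by (simp add: field_simps)
    then show ?thesis using \<theta> by linarith
  qed
  finally have "(\<gamma> - 1) * (1 - m * \<theta>) \<le> \<epsilon>\<^sup>2" using assms(9) by simp
  moreover have "2 * \<epsilon> * (1 - m * \<theta>) \<le> (\<gamma> - 1) * (1 - m * \<theta>)"
    using \<gamma>(1) assms(4) by (intro mult_right_mono) auto
  moreover have "2 * \<epsilon> * (1 - m * \<theta>) = \<epsilon> * (2 * (1 - m * \<theta>))" by simp
  ultimately have "\<epsilon> * (2 * (1 - m * \<theta>)) \<le> \<epsilon> * \<epsilon>"
    unfolding power2_eq_square by linarith
  then have "2 * (1 - m * \<theta>) \<le> \<epsilon>" using assms(8) by simp
  then show ?thesis by simp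
qed

lemma principal_value_imp_complete_multipartite:
  fixes \<epsilon> :: real
  assumes "0 < \<epsilon>" "2 \<le> k"
  shows "\<exists>c>0. \<exists>n0. \<forall>(S :: 'a set) E \<mu> x. finite S \<longrightarrow> n0 \<le> card S \<longrightarrow> symp_on S E \<longrightarrow>
    irreflp_on S E \<longrightarrow> is_principal_pair S E \<mu> x \<longrightarrow>
    (1 - 1 / real k + \<epsilon>) * (2 * real (card S)) \<le> \<mu> \<longrightarrow>
    (\<exists>t. c * ln (real (card S)) \<le> real t \<and> complete_multipartite_in S E (Suc k) t)"
proof -
  have "0 < \<epsilon> / 2" "1 \<le> k" using assms by simp_all
  from edge_density_imp_complete_multipartite[OF this, where 'a = 'a]
  obtain c n0 where c: "c > 0" and density: "\<forall>(S :: 'a set) E. finite S \<longrightarrow> n0 \<le> card S \<longrightarrow>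
    symp_on S E \<longrightarrow> irreflp_on S E \<longrightarrow>
    (1 - 1 / real k + \<epsilon> / 2) * (real (card S))\<^sup>2 \<le> (\<Sum>u\<in>S. real (degree_in S E u)) \<longrightarrow>
    (\<exists>t. c * ln (real (card S)) \<le> real t \<and> complete_multipartite_in S E (Suc k) t)"
    by (elim exE conjE) (rule that)
  \<comment> \<open>\<delta> is quadratic in \<epsilon> because the deletion estimate divides it by
    a gap of order \<epsilon>; \<kappa> solves \<open>\<kappa> powr \<delta> = 1 / 2\<close>,
    matching the size bound for the maximiser.\<close>
  define \<delta> where "\<delta> = \<epsilon>\<^sup>2 / 4"
  define \<kappa> where "\<kappa> = (1 / 2) powr (1 / \<delta>)"
  define \<alpha> where "\<alpha> = 1 - 1 / real k + \<epsilon>"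
  have \<delta>0: "0 < \<delta>" using assms(1) by (simp add: \<delta>_def)
  have \<kappa>: "0 < \<kappa>" by (simp add: \<kappa>_def)
  have \<alpha>: "1 / 2 + \<epsilon> \<le> \<alpha>" using assms(2) by (simp add: \<alpha>_def field_simps)
  \<comment> \<open>\<open>n0\<close> serves the density lemma, 2 keeps the set nonempty after a
    deletion, and \<open>4 / \<epsilon>\<^sup>2\<close> is what \<open>near_uniform_estimate\<close>
    asks for.\<close>
  from eventually_linear_large[OF \<kappa>, of "max (real n0) (max 2 (4 / \<epsilon>\<^sup>2))"]
  obtain n1 where n1: "\<And>n. n1 \<le> n \<Longrightarrow>
      max (real n0) (max 2 (4 / \<epsilon>\<^sup>2)) \<le> \<kappa> * real n \<and> ln (real n) / 2 \<le> ln (\<kappa> * real n)"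
    unfolding eventually_sequentially by blast
  show ?thesis
  proof (rule exI[of _ "c / 2"], rule conjI, use c in simp, rule exI[of _ n1], intro allI impI)
    fix S :: "'a set" and E \<mu> x
    assume fin: "finite S" and n: "n1 \<le> card S" and sym: "symp_on S E" and irr: "irreflp_on S E"
      and pair: "is_principal_pair S E \<mu> x"
      and large: "(1 - 1 / real k + \<epsilon>) * (2 * real (card S)) \<le> \<mu>"
    define N where "N = real (card S)"
    have "0 < \<kappa> * N" using n1[OF n] by (simp add: N_def)
    then have N: "0 < N" using \<kappa> by (simp add: zero_less_mult_iff)
    then have "S \<noteq> {}" by (auto simp: N_def)
    \<comment> \<open>The hypothesis itself bounds \<epsilon>: no principal value exceeds
      \<open>2 * N\<close>. Hence \<open>\<delta> < 1\<close>, and the exponent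
      \<open>1 - \<delta>\<close> is positive.\<close>
    have "\<alpha> * (2 * N) \<le> 2 * N"
      using large principal_value_le[OF fin sym pair] by (simp add: \<alpha>_def N_def)
    then have "\<alpha> \<le> 1" using N by simp
    then have "\<epsilon> \<le> 1 / 2" using \<alpha> by linarith
    then have "\<epsilon>\<^sup>2 \<le> 1\<^sup>2" using assms(1) by (intro power_mono) auto
    then have \<delta>1: "\<delta> < 1" by (simp add: \<delta>_def)
    have sub: "finite R" "symp_on R E" "irreflp_on R E" if "R \<subseteq> S" for R
      using finite_subset[OF that fin] symp_on_subset[OF sym that] irreflp_on_subset[OF irr that]
      by simp_all
    have "\<exists>p. is_principal_pair R E (fst p) (snd p)" if "R \<subseteq> S" "R \<noteq> {}" for R
      using principal_pair_exists[OF sub(1)[OF that(1)] that(2), of E] by simp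
    then obtain p where p: "\<And>R. R \<subseteq> S \<Longrightarrow> R \<noteq> {} \<Longrightarrow> is_principal_pair R E (fst (p R)) (snd (p R))"
      by metis
    define q where "q R = fst (p R)" for R
    define y where "y R = snd (p R)" for R
    have pp: "is_principal_pair R E (q R) (y R)" if "R \<subseteq> S" "R \<noteq> {}" for R
      using p[OF that] by (simp add: q_def y_def)
    \<comment> \<open>The pair chosen for \<open>S\<close> need not be the given one, but its value
      bounds the form at \<open>x\<close>.\<close>
    have "\<mu> \<le> q S"
    proof -
      have "sl_form S E x \<le> q S * (\<Sum>i\<in>S. (x i)\<^sup>2)"
        using pp[OF order_refl \<open>S \<noteq> {}\<close>] by (simp add: is_principal_pair_def)
      then show ?thesis using pair by (simp add: is_principal_pair_def)
    qed
    moreover have "2 * \<alpha> * N = (1 - 1 / real k + \<epsilon>) * (2 * real (card S))"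
      by (simp add: \<alpha>_def N_def)
    ultimately have qS: "2 * \<alpha> * N \<le> q S" using large by linarith
    \<comment> \<open>With exponent 1 a small set could be optimal; the missing \<delta> rewards
      size, yet is small enough for deletions to remain informative.\<close>
    define g where "g R = q R / real (card R) powr (1 - \<delta>)" for R
    obtain R where "R \<in> Pow S - {{}}" and max: "\<And>R'. R' \<in> Pow S - {{}} \<Longrightarrow> g R' \<le> g R"
      using finite_maximizer[of "Pow S - {{}}" g] fin \<open>S \<noteq> {}\<close> by blast
    then have R: "R \<subseteq> S" "R \<noteq> {}" by auto
    define m where "m = real (card R)"
    have m0: "0 < m" using R sub(1)[OF R(1)] by (simp add: m_def card_gt_0_iff)
    have "m \<le> N" using R(1) fin by (simp add: m_def N_def card_mono)
    have q_upper: "q R \<le> 2 * m"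
      using principal_value_le[OF sub(1,2)[OF R(1)] pp[OF R]] by (simp add: m_def)
    have gSR: "2 * \<alpha> * N powr \<delta> \<le> q R / m powr (1 - \<delta>)"
    proof -
      have "2 * \<alpha> * N powr \<delta> = 2 * \<alpha> * N / N powr (1 - \<delta>)"
        using N by (simp add: powr_diff)
      also have "\<dots> \<le> g S" using qS N by (simp add: g_def N_def divide_right_mono)
      also have "\<dots> \<le> g R" using max \<open>S \<noteq> {}\<close> by simp
      finally show ?thesis by (simp add: g_def m_def)
    qed
    have "q R / m powr (1 - \<delta>) \<le> 2 * m powr \<delta>"
      using q_upper m0 by (simp add: powr_diff field_simps)
    then have "\<alpha> * N powr \<delta> \<le> m powr \<delta>" using gSR by linarith
    moreover have "1 / 2 * N powr \<delta> \<le> \<alpha> * N powr \<delta>"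
      using \<alpha> assms(1) by (intro mult_right_mono) auto
    ultimately have "(1 / 2 * N powr \<delta>) powr (1 / \<delta>) \<le> (m powr \<delta>) powr (1 / \<delta>)"
      using \<delta>0 by (intro powr_mono2) auto
    moreover have "(1 / 2 * N powr \<delta>) powr (1 / \<delta>) = \<kappa> * N"
      using N \<delta>0 powr_mult[of "1 / 2" "N powr \<delta>" "1 / \<delta>"] by (simp add: powr_powr \<kappa>_def)
    moreover have "(m powr \<delta>) powr (1 / \<delta>) = m"
      using m0 \<delta>0 by (simp add: powr_powr)
    ultimately have m: "\<kappa> * N \<le> m" by simp
    have m_big: "real n0 \<le> m" "2 \<le> m" "4 / \<epsilon>\<^sup>2 \<le> m"
      using n1[OF n] m by (simp_all add: N_def)
    have q_lower: "2 * \<alpha> * m \<le> q R"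
    proof -
      have "2 * \<alpha> * m = 2 * \<alpha> * m powr \<delta> * m powr (1 - \<delta>)"
        using m0 by (simp add: powr_diff)
      also have "\<dots> \<le> 2 * \<alpha> * N powr \<delta> * m powr (1 - \<delta>)"
        using \<open>m \<le> N\<close> m0 \<delta>0 \<alpha> assms(1) by (intro mult_right_mono mult_left_mono powr_mono2) auto
      also have "\<dots> \<le> q R" using gSR m0 by (simp add: field_simps)
      finally show ?thesis .
    qed
    obtain v where v: "v \<in> R" "\<And>i. i \<in> R \<Longrightarrow> y R v \<le> y R i"
      using finite_maximizer[of R "\<lambda>i. - y R i"] sub(1)[OF R(1)] R(2) by auto
    define \<theta> where "\<theta> = (y R v)\<^sup>2"
    have y: "\<And>i. 0 \<le> y R i" "(\<Sum>i\<in>R. (y R i)\<^sup>2) = 1"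
      using pp[OF R] by (auto simp: is_principal_pair_def)
    have \<theta>_le: "\<theta> \<le> (y R i)\<^sup>2" if "i \<in> R" for i
      unfolding \<theta>_def using v(2)[OF that] y(1) by (intro power_mono) auto
    have m\<theta>: "m * \<theta> \<le> 1"
      using sum_bounded_below[of R \<theta> "\<lambda>i. (y R i)\<^sup>2"] \<theta>_le y(2) by (simp add: m_def)
    have card': "real (card (R - {v})) = m - 1"
      using v(1) m0 sub(1)[OF R(1)] by (simp add: m_def card_Diff_singleton of_nat_diff Suc_leI)
    then have "R - {v} \<noteq> {}" using m_big(2) by force
    then have R': "R - {v} \<subseteq> S" "R - {v} \<noteq> {}" using R(1) by auto
    \<comment> \<open>Maximality of \<open>R\<close> against \<open>R - {v}\<close>, with the power
      of \<open>(m - 1) / m\<close> linearised by Bernoulli.\<close>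
    have "q (R - {v}) \<le> q R * (1 - (1 - \<delta>) / m)"
    proof -
      have "q (R - {v}) / (m - 1) powr (1 - \<delta>) \<le> q R / m powr (1 - \<delta>)"
        using max[of "R - {v}"] R' card' by (simp add: g_def m_def)
      then have "q (R - {v}) \<le> q R / m powr (1 - \<delta>) * (m - 1) powr (1 - \<delta>)"
        using m_big(2) by (simp add: field_simps)
      also have "\<dots> = q R * (1 - 1 / m) powr (1 - \<delta>)"
        using m_big(2) powr_divide[of "m - 1" m "1 - \<delta>"] by (simp add: diff_divide_distrib)
      also have "\<dots> \<le> q R * (1 - (1 - \<delta>) * (1 / m))"
        using m_big(2) \<delta>0 \<delta>1 q_lower \<alpha> assms(1) m0
        by (intro mult_left_mono Bernoulli_powr_le) (auto intro: order_trans[rotated])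
      finally show ?thesis by simp
    qed
    moreover have "q R - 1 + m * \<theta> - 2 * q R * \<theta> \<le> q (R - {v}) * (1 - \<theta>)"
      using principal_value_delete_min[OF sub[OF R(1)] pp[OF R] v pp[OF R']]
      by (simp add: \<theta>_def m_def)
    moreover have "(1 + 2 * \<epsilon>) * m \<le> q R"
    proof -
      have "(1 + 2 * \<epsilon>) * m \<le> 2 * \<alpha> * m" using \<alpha> m0 by (intro mult_right_mono) auto
      then show ?thesis using q_lower by linarith
    qed
    ultimately have uniform: "1 - m * \<theta> \<le> \<epsilon> / 2"
      using near_uniform_estimate[of "q R" m \<theta> "q (R - {v})" \<delta> \<epsilon>] m\<theta> m_big q_upper assms(1)
      by (simp add: \<theta>_def \<delta>_def)
    define e where "e = (\<Sum>i\<in>R. real (degree_in R E i))"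
    have "2 * \<alpha> * m \<le> 2 * \<theta> * e + 2 * m * (1 - m * \<theta>)"
      using principal_pair_degree_sum[OF sub(1,2)[OF R(1)] pp[OF R] _ \<theta>_le] q_lower
      by (simp add: e_def m_def \<theta>_def)
    \<comment> \<open>The degree sum is weighted by \<open>\<theta> \<le> 1 / m\<close>, and
      near-uniformity bounds the excess; multiplying by \<open>m / 2\<close> turns this into an edge
      density.\<close>
    also have "\<dots> \<le> 2 * (1 / m) * e + 2 * m * (\<epsilon> / 2)"
      using uniform m\<theta> m0
      by (intro add_mono mult_right_mono mult_left_mono) (auto simp: e_def field_simps intro: sum_nonneg)
    finally have "(\<alpha> - \<epsilon> / 2) * m\<^sup>2 \<le> e"
      using m0 by (simp add: field_simps power2_eq_square)
    then have "(1 - 1 / real k + \<epsilon> / 2) * (real (card R))\<^sup>2 \<le> (\<Sum>i\<in>R. real (degree_in R E i))"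
      by (simp add: e_def \<alpha>_def m_def add.commute)
    then obtain t where t: "c * ln m \<le> real t" "complete_multipartite_in R E (Suc k) t"
      using density[rule_format, OF sub(1)[OF R(1)] _ sub(2,3)[OF R(1)]] m_big(1)
      by (auto simp: m_def)
    have "ln (\<kappa> * N) \<le> ln m" using m \<open>0 < \<kappa> * N\<close> by simp
    then have "ln N / 2 \<le> ln m" using n1[OF n] by (simp add: N_def)
    then have "c / 2 * ln N \<le> c * ln m"
      using c mult_left_mono[of "ln N / 2" "ln m" c] by simp
    then show "\<exists>t. c / 2 * ln (real (card S)) \<le> real t \<and> complete_multipartite_in S E (Suc k) t"
      using t R(1) complete_multipartite_in_mono unfolding N_def by (meson order_trans order_refl)
  qed
qed

section \<open>The signless Laplacian matrix\<close>

lemma signless_laplacian_carrier: "signless_laplacian n E \<in> carrier_mat n n"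
  by (simp add: signless_laplacian_def)

lemma signless_laplacian_mult_vec:
  assumes "i < n" "v \<in> carrier_vec n"
  shows "(signless_laplacian n E *\<^sub>v v) $ i = (\<Sum>j<n. of_bool (E i j) * (v $ i + v $ j))"
proof -
  have deg: "real (degree n E i) = (\<Sum>j<n. of_bool (E i j))"
    by (simp add: degree_def lessThan_def Int_def)
  have "(signless_laplacian n E *\<^sub>v v) $ i
      = (\<Sum>j<n. ((if i = j then real (degree n E i) else 0) + of_bool (E i j)) * v $ j)"
    using assms
    by (auto simp: signless_laplacian_def scalar_prod_def of_bool_def lessThan_atLeast0 intro!: sum.cong)
  also have "\<dots> = (\<Sum>j<n. if i = j then real (degree n E i) * v $ i else 0) + (\<Sum>j<n. of_bool (E i j) * v $ j)"
    unfolding sum.distrib[symmetric] by (intro sum.cong refl) (simp add: distrib_right)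
  also have "(\<Sum>j<n. if i = j then real (degree n E i) * v $ i else 0) = (\<Sum>j<n. of_bool (E i j) * v $ i)"
    unfolding deg sum_distrib_right using assms(1) by simp
  finally show ?thesis by (simp only: sum.distrib[symmetric] distrib_left)
qed

text \<open>Pairing an eigenvector with its image under the matrix gives the form, so the maximality
  in the principal pair bounds every eigenvalue.\<close>

lemma q_index_le_principal_value:
  assumes "0 < n" "simple_graph n E" "is_principal_pair {..<n} E \<mu> x"
  shows "q_index n E \<le> \<mu>"
proof -
  let ?Q = "signless_laplacian n E"
  have sym: "symp_on {..<n} E" and irr: "irreflp_on {..<n} E"
    using assms(2) by (auto simp: simple_graph_def symp_on_def irreflp_on_def)
  have x: "(\<Sum>i<n. (x i)\<^sup>2) = 1" "\<And>y. sl_form {..<n} E y \<le> \<mu> * (\<Sum>i<n. (y i)\<^sup>2)"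
    using assms(3) by (auto simp: is_principal_pair_def)
  have upper: "\<nu> \<le> \<mu>" if "eigenvalue ?Q \<nu>" for \<nu>
  proof -
    obtain v where v: "v \<in> carrier_vec n" "v \<noteq> 0\<^sub>v n" "?Q *\<^sub>v v = \<nu> \<cdot>\<^sub>v v"
      using \<open>eigenvalue ?Q \<nu>\<close> unfolding eigenvalue_def eigenvector_def
      by (auto simp: signless_laplacian_def)
    have "\<nu> * v $ i = (\<Sum>j<n. of_bool (E i j) * (v $ i + v $ j))" if "i < n" for i
      using signless_laplacian_mult_vec[OF that v(1), of E] v(1,3) that by simp
    then have "(\<Sum>i<n. v $ i * (\<nu> * v $ i)) = sl_form {..<n} E (($) v)"
      unfolding sl_form_eq_bilinear[OF sym] by (intro sum.cong) auto
    then have "\<nu> * (\<Sum>i<n. (v $ i)\<^sup>2) = sl_form {..<n} E (($) v)"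
      by (simp add: sum_distrib_left power2_eq_square mult_ac)
    also have "\<dots> \<le> \<mu> * (\<Sum>i<n. (v $ i)\<^sup>2)" by (rule x(2))
    finally have "\<nu> * (\<Sum>i<n. (v $ i)\<^sup>2) \<le> \<mu> * (\<Sum>i<n. (v $ i)\<^sup>2)" .
    moreover have "0 < (\<Sum>i<n. (v $ i)\<^sup>2)"
    proof -
      obtain i where "i < n" "v $ i \<noteq> 0"
        using v(1,2) by (metis carrier_vecD eq_vecI index_zero_vec)
      then show ?thesis by (intro sum_pos2[of _ i]) auto
    qed
    ultimately show ?thesis by simp
  qed
  \<comment> \<open>\<open>Max\<close> is meaningful only on a finite nonempty set: \<mu> itself
    shows that the spectrum is nonempty, and the characteristic polynomial that it is
    finite.\<close>
  have "eigenvalue ?Q \<mu>"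
    unfolding eigenvalue_def eigenvector_def
  proof (intro exI[of _ "vec n x"] conjI)
    show "vec n x \<in> carrier_vec (dim_row ?Q)" by (simp add: signless_laplacian_def)
    show "vec n x \<noteq> 0\<^sub>v (dim_row ?Q)"
    proof
      assume "vec n x = 0\<^sub>v (dim_row ?Q)"
      then have "vec n x $ i = 0\<^sub>v n $ i" for i
        by (simp add: signless_laplacian_def)
      then have "x i = 0" if "i < n" for i
        using that by (metis index_vec index_zero_vec(1))
      then show False using x(1) by simp
    qed
    show "?Q *\<^sub>v vec n x = \<mu> \<cdot>\<^sub>v vec n x"
    proof (rule eq_vecI)
      fix i assume "i < dim_vec (\<mu> \<cdot>\<^sub>v vec n x)"
      then have i: "i < n" by simp
      have "(?Q *\<^sub>v vec n x) $ i = (\<Sum>j<n. of_bool (E i j) * (x i + x j))"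
        using signless_laplacian_mult_vec[OF i, of "vec n x" E] i by simp
      also have "\<dots> = \<mu> * x i"
        using principal_pair_eigen_equation[OF _ sym irr assms(3)] i by simp
      finally show "(?Q *\<^sub>v vec n x) $ i = (\<mu> \<cdot>\<^sub>v vec n x) $ i" using i by simp
    qed (simp add: signless_laplacian_def)
  qed
  moreover have "finite {\<nu>. eigenvalue ?Q \<nu>}"
  proof -
    have "char_poly ?Q \<noteq> 0"
      using degree_monic_char_poly[OF signless_laplacian_carrier, of n E] by auto
    then show ?thesis
      unfolding eigenvalue_root_char_poly[OF signless_laplacian_carrier] by (rule poly_roots_finite)
  qed
  ultimately show ?thesis
    unfolding q_index_def using upper by (intro Max.boundedI) auto
qed

theorem theorem2p3:
  fixes k :: nat and \<epsilon> :: real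
  assumes "k \<ge> 2" and "\<epsilon> > 0"
  shows "\<exists>c::real > 0. \<exists>n0::nat. \<forall>n \<ge> n0. \<forall>E :: nat \<Rightarrow> nat \<Rightarrow> bool.
           simple_graph n E \<longrightarrow>
           q_index n E \<ge> (1 - 1 / real k + \<epsilon>) * (2 * real n) \<longrightarrow>
           (\<exists>t::nat. t \<ge> 1 \<and> real t \<ge> c * ln (real n) \<and>
              contains_complete_multipartite n E (k + 1) t)"
proof -
  from principal_value_imp_complete_multipartite[OF assms(2,1), where 'a = nat]
  obtain c n0 where c: "c > 0" and *: "\<forall>(S :: nat set) E \<mu> x. finite S \<longrightarrow> n0 \<le> card S \<longrightarrow> symp_on S E \<longrightarrow>
    irreflp_on S E \<longrightarrow> is_principal_pair S E \<mu> x \<longrightarrow>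
    (1 - 1 / real k + \<epsilon>) * (2 * real (card S)) \<le> \<mu> \<longrightarrow>
    (\<exists>t. c * ln (real (card S)) \<le> real t \<and> complete_multipartite_in S E (Suc k) t)"
    by (elim exE conjE) (rule that)
  show ?thesis
  \<comment> \<open>From \<open>n \<ge> 2\<close> on, \<open>ln n\<close> is positive, which rules
    out the degenerate class size 0.\<close>
  proof (rule exI[of _ c], rule conjI, rule c, rule exI[of _ "max 2 n0"], intro allI impI)
    fix n :: nat and E :: "nat \<Rightarrow> nat \<Rightarrow> bool"
    assume n: "max 2 n0 \<le> n" and G: "simple_graph n E"
      and q: "(1 - 1 / real k + \<epsilon>) * (2 * real n) \<le> q_index n E"
    have sym: "symp_on {..<n} E" and irr: "irreflp_on {..<n} E"
      using G by (auto simp: simple_graph_def symp_on_def irreflp_on_def)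
    have "0 < n" using n by simp
    then obtain \<mu> x where pair: "is_principal_pair {..<n} E \<mu> x"
      using principal_pair_exists[of "{..<n}" E] by auto
    have "(1 - 1 / real k + \<epsilon>) * (2 * real n) \<le> \<mu>"
      using q q_index_le_principal_value[OF \<open>0 < n\<close> G pair] by linarith
    then obtain t where t: "c * ln (real n) \<le> real t" "complete_multipartite_in {..<n} E (Suc k) t"
      using *[rule_format, OF _ _ sym irr pair] n by auto
    have "0 < c * ln (real n)" using c n by simp
    then have "1 \<le> t" using t(1) by (cases t) auto
    moreover obtain V where V: "\<forall>i<Suc k. V i \<subseteq> {..<n} \<and> card (V i) = t"
      "\<forall>i<Suc k. \<forall>j<Suc k. i \<noteq> j \<longrightarrow> (\<forall>u\<in>V i. \<forall>v\<in>V j. E u v)"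
      using t(2) unfolding complete_multipartite_in_def by auto
    \<comment> \<open>A vertex common to two classes would be adjacent to itself.\<close>
    have "V i \<inter> V j = {}" if "i < Suc k" "j < Suc k" "i \<noteq> j" for i j
    proof -
      have "E u u" "u < n" if "u \<in> V i \<inter> V j" for u
        using that V \<open>i < Suc k\<close> \<open>j < Suc k\<close> \<open>i \<noteq> j\<close> by blast+
      then show ?thesis using G by (auto simp: simple_graph_def)
    qed
    then have "contains_complete_multipartite n E (k + 1) t"
      using V unfolding contains_complete_multipartite_def by (intro exI[of _ V]) simp
    ultimately show "\<exists>t. 1 \<le> t \<and> c * ln (real n) \<le> real t \<and> contains_complete_multipartite n E (k + 1) t"
      using t(1) by blast
  qed
qed

end
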